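(* For $n\geq1$, $$T_{n+1}^E(x)=nxT_n^E(x)+2x(1-x)\frac{d}{dx}T_n^E(x)+xT_n^O(x),$$ $$T_{n+1}^O(x)=((n-1)x+1)T_n^O(x)+2x(1-x)\frac{d}{dx}T_n^O(x)+T_n^E(x),$$ with $T_1^E(x)=0$ and $T_1^O(x)=1$. Moreover, both $T_n^E(x)$ and $T_n^O(x)$ have only real negative zeros and $T_n^O(x)\prec T_n^E(x)$.
   Context: $\mathcal{S}_n$ is the symmetric group on $[n]$, $\pi=\pi(1)\cdots\pi(n)$, with the convention $\pi(0)=0$. The left peak number is ${\rm lpk}(\pi)=\#\{i\in[n-1]:\pi(i-1)<\pi(i)>\pi(i+1)\}$. Let $\mathcal{S}_n^+=\{\pi\in\mathcal{S}_n:\pi(n-1)>\pi(n)\}$, $\mathcal{S}_n^-=\{\pi\in\mathcal{S}_n:\pi(n-1)<\pi(n)\}$, $T_n^E(x)=\sum_{\pi\in\mathcal{S}_n^+}x^{{\rm lpk}(\pi)}$, $T_n^O(x)=\sum_{\pi\in\mathcal{S}_n^-}x^{{\rm lpk}(\pi)}$. For real-rooted polynomials $p,q$ with zeros $\xi_1\le\cdots\le\xi_n$ and $\theta_1\le\cdots\le\theta_m$, $p\prec q$ means either $\deg q=\deg p+1$ and $\theta_1\le\xi_1\le\theta_2\le\cdots\le\xi_n\le\theta_{n+1}$, or $\deg p=\deg q$ and $\xi_1\le\theta_1\le\xi_2\le\cdots\le\xi_n\le\theta_n$.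
   Formalization: Since x divides T_n^E for n≥2 (e.g. T_2^E = x), "only real negative zeros" for T_n^E is proved after discarding one zero at the origin (a simple zero); for n=1 the zero polynomial T_1^E counts as real-rooted of degree 0 with no zeros, so T_1^O ≺ T_1^E holds by convention. *)

theory Defs
  imports
    "HOL-Computational_Algebra.Computational_Algebra"
    "HOL-Combinatorics.Permutations"
    Complex_Main
begin

text \<open>
  A permutation of \<open>{1..n}\<close> is a function that \<open>permutes {1..n}\<close>. It fixes \<open>0\<close>, so the convention
  \<open>\<pi> 0 = 0\<close> holds automatically.
\<close>

definition lpk :: "nat \<Rightarrow> (nat \<Rightarrow> nat) \<Rightarrow> nat" where
  "lpk n \<pi> = card {i \<in> {1..n-1}. \<pi> (i - 1) < \<pi> i \<and> \<pi> i > \<pi> (i + 1)}"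

definition S_plus :: "nat \<Rightarrow> (nat \<Rightarrow> nat) set" where
  "S_plus n = {\<pi>. \<pi> permutes {1..n} \<and> \<pi> (n - 1) > \<pi> n}"

definition S_minus :: "nat \<Rightarrow> (nat \<Rightarrow> nat) set" where
  "S_minus n = {\<pi>. \<pi> permutes {1..n} \<and> \<pi> (n - 1) < \<pi> n}"

definition T_E :: "nat \<Rightarrow> real poly" where
  "T_E n = (\<Sum>\<pi>\<in>S_plus n. monom 1 (lpk n \<pi>))"

definition T_O :: "nat \<Rightarrow> real poly" where
  "T_O n = (\<Sum>\<pi>\<in>S_minus n. monom 1 (lpk n \<pi>))"

text \<open>
  The complex zeros with multiplicities. Note that \<open>proots 0 = {#}\<close>: the zero polynomial is
  regarded as a real-rooted polynomial of degree \<open>0\<close> with an empty list of zeros; this only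
  concerns \<open>T_E 1\<close>.

  For \<open>n \<ge> 2\<close> a permutation in \<open>S_plus n\<close> has at least one left peak, so \<open>0\<close> is a zero of \<open>T_E n\<close>.
  "Only negative zeros" can therefore hold for \<open>T_E n\<close> only after this trivial zero is discarded
  (once), that is, for the multiset \<open>complex_zeros (T_E n) - {#0#}\<close>.
\<close>

definition complex_zeros :: "real poly \<Rightarrow> complex multiset" where
  "complex_zeros p = proots (map_poly complex_of_real p)"

definition real_rooted :: "real poly \<Rightarrow> bool" where
  "real_rooted p \<longleftrightarrow> (\<forall>z \<in># complex_zeros p. z \<in> \<real>)"

definition sorted_zeros :: "real poly \<Rightarrow> real list" where
  "sorted_zeros p = sorted_list_of_multiset (proots p)"

text \<open>
  With 0-based lists \<open>\<xi>\<close> and \<open>\<theta>\<close> of the zeros of \<open>p\<close> and \<open>q\<close>, the two alternatives read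
  \<open>\<theta>!0 \<le> \<xi>!0 \<le> \<theta>!1 \<le> \<dots> \<le> \<xi>!(d-1) \<le> \<theta>!d\<close> and
  \<open>\<xi>!0 \<le> \<theta>!0 \<le> \<xi>!1 \<le> \<dots> \<le> \<xi>!(d-1) \<le> \<theta>!(d-1)\<close>, where \<open>d = degree p\<close>.
\<close>

definition interlaces :: "real poly \<Rightarrow> real poly \<Rightarrow> bool"  (infix "\<prec>" 50) where
  "p \<prec> q \<longleftrightarrow> real_rooted p \<and> real_rooted q \<and>
     (let \<xi> = sorted_zeros p; \<theta> = sorted_zeros q; d = degree p in
        (degree q = d + 1 \<and> (\<forall>i<d. \<theta> ! i \<le> \<xi> ! i \<and> \<xi> ! i \<le> \<theta> ! (i + 1))) \<or>
        (degree q = d \<and> (\<forall>i<d. \<xi> ! i \<le> \<theta> ! i) \<and>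
           (\<forall>i. i + 1 < d \<longrightarrow> \<theta> ! i \<le> \<xi> ! (i + 1))))"

end

theory Submission
  imports Defs
begin

text \<open>
  Inserting \<open>n + 1\<close> into the word of a permutation of \<open>{1..n}\<close> either keeps the number of left peaks
  (next to an old peak, or at the end) or raises it by one; this gives both recurrences.

  They combine into one: \<open>R\<^sub>n(x) = T_E n (x\<^sup>2) + x T_O n (x\<^sup>2)\<close> has degree \<open>n\<close> and satisfies
  \<open>R\<^sub>n\<^sub>+\<^sub>1 = (n x\<^sup>2 + x) R\<^sub>n + x (1 - x\<^sup>2) R\<^sub>n'\<close>. If \<open>r\<close> runs over the zeros of \<open>R\<^sub>n\<close>, then
  \<open>R\<^sub>n\<^sub>+\<^sub>1 / (x R\<^sub>n) = 1 + \<Sum> (1 - r x) / (x - r)\<close>, and every summand has nonnegative real part for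
  \<open>Re x \<ge> 0\<close> when \<open>Re r \<le> 0\<close>. So, inductively, all zeros of \<open>R\<^sub>n\<close> except the simple zero \<open>0\<close> lie in the
  open left half plane.

  As in the Hermite-Biehler theorem, the argument of \<open>R\<^sub>n(i y) / (i y)\<close> therefore increases strictly
  from \<open>0\<close> at \<open>y = 0\<close> to \<open>(n - 1) \<pi>/2\<close>. It equals \<open>k \<pi>/2\<close> at a point \<open>y\<^sub>k\<close> for each \<open>k < n - 1\<close>, and
  \<open>- y\<^sub>k\<^sup>2\<close> is a zero of \<open>T_E n\<close> for even \<open>k\<close> and of \<open>T_O n\<close> for odd \<open>k\<close>. By degree, these are all the zeros.
\<close>

section \<open>Recurrences\<close>

definition peaks :: "nat \<Rightarrow> (nat \<Rightarrow> nat) \<Rightarrow> nat set" where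
  "peaks n \<pi> = {i \<in> {1..n-1}. \<pi> (i - 1) < \<pi> i \<and> \<pi> i > \<pi> (i + 1)}"

text \<open>Slot \<open>k\<close> lies directly after position \<open>k\<close>, so these are the slots next to a left peak.\<close>

definition peak_slots :: "nat \<Rightarrow> (nat \<Rightarrow> nat) \<Rightarrow> nat set" where
  "peak_slots n \<pi> = {k. k \<in> peaks n \<pi> \<or> Suc k \<in> peaks n \<pi>}"

text \<open>\<open>\<pi> \<circ> insert_cycle n k\<close> is the word of \<open>\<pi>\<close> with \<open>n + 1\<close> inserted into slot \<open>k\<close>.\<close>

definition insert_cycle :: "nat \<Rightarrow> nat \<Rightarrow> nat \<Rightarrow> nat" where
  "insert_cycle n k i =
     (if i \<le> k then i else if i = k + 1 then n + 1 else if i \<le> n + 1 then i - 1 else i)"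

lemma finite_peaks [simp]: "finite (peaks n \<pi>)"
  by (simp add: peaks_def)

lemma lpk_eq_card_peaks: "lpk n \<pi> = card (peaks n \<pi>)"
  by (simp add: lpk_def peaks_def)

lemma peaks_not_adjacent: "i \<in> peaks n \<pi> \<Longrightarrow> Suc i \<notin> peaks n \<pi>"
  by (auto simp: peaks_def)

text \<open>Each peak \<open>i\<close> owns the two slots \<open>i - 1\<close> and \<open>i\<close>.
  Since neighbouring positions are never both peaks, no slot is shared.\<close>

lemma card_peak_slots: "finite (peak_slots n \<pi>)" "card (peak_slots n \<pi>) = 2 * lpk n \<pi>"
proof -
  have eq: "peak_slots n \<pi> = peaks n \<pi> \<union> (\<lambda>i. i - 1) ` peaks n \<pi>"
  proof (rule set_eqI)
    fix k
    have "Suc k \<in> peaks n \<pi> \<longleftrightarrow> k \<in> (\<lambda>i. i - 1) ` peaks n \<pi>"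
    proof
      assume "k \<in> (\<lambda>i. i - 1) ` peaks n \<pi>"
      then obtain i where "i \<in> peaks n \<pi>" "k = i - 1" by auto
      moreover from this have "i \<ge> 1" by (simp add: peaks_def)
      ultimately show "Suc k \<in> peaks n \<pi>" by simp
    qed force
    then show "k \<in> peak_slots n \<pi> \<longleftrightarrow> k \<in> peaks n \<pi> \<union> (\<lambda>i. i - 1) ` peaks n \<pi>"
      by (simp add: peak_slots_def)
  qed
  have inj: "inj_on (\<lambda>i. i - 1) (peaks n \<pi>)"
    by (auto simp: inj_on_def peaks_def)
  have disj: "peaks n \<pi> \<inter> (\<lambda>i. i - 1) ` peaks n \<pi> = {}"
  proof (rule ccontr)
    assume "peaks n \<pi> \<inter> (\<lambda>i. i - 1) ` peaks n \<pi> \<noteq> {}"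
    then obtain i where i: "i \<in> peaks n \<pi>" "i - 1 \<in> peaks n \<pi>" by auto
    then have "Suc (i - 1) = i" by (auto simp: peaks_def)
    with i peaks_not_adjacent show False by metis
  qed
  show "finite (peak_slots n \<pi>)" by (simp add: eq)
  show "card (peak_slots n \<pi>) = 2 * lpk n \<pi>"
    using card_Un_disjoint[OF finite_peaks _ disj] card_image[OF inj]
    by (simp only: eq lpk_eq_card_peaks finite_imageI finite_peaks mult_2)
qed

text \<open>Peaks lie at positions at most \<open>n - 1\<close>, so the final slot \<open>n\<close>
  touches none. A final ascent also rules out a peak at \<open>n - 1\<close>, which frees slot
  \<open>n - 1\<close>.\<close>

lemma peak_slots_subset:
  "peak_slots n \<pi> \<subseteq> {..<n}"
  "\<pi> (n - 1) < \<pi> n \<Longrightarrow> peak_slots n \<pi> \<subseteq> {..<n-1}"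
proof -
  show "peak_slots n \<pi> \<subseteq> {..<n}" by (auto simp: peak_slots_def peaks_def)
  assume *: "\<pi> (n - 1) < \<pi> n"
  have "i < n - 1" if "i \<in> peaks n \<pi>" for i
  proof (rule ccontr)
    assume "\<not> i < n - 1"
    with that have "i = n - 1" "i + 1 = n" by (auto simp: peaks_def)
    with that * show False by (simp add: peaks_def)
  qed
  then show "peak_slots n \<pi> \<subseteq> {..<n-1}" by (fastforce simp: peak_slots_def)
qed

text \<open>Counting slots next to peaks gives these bounds, which later become the degree bounds
  for \<open>T_E\<close> and \<open>T_O\<close>.\<close>

lemma lpk_le:
  "2 * lpk n \<pi> \<le> n"
  "\<pi> (n - 1) < \<pi> n \<Longrightarrow> 2 * lpk n \<pi> \<le> n - 1"
  using card_mono[OF _ peak_slots_subset(1)[of n \<pi>]] card_mono[OF _ peak_slots_subset(2)[of \<pi> n]]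
  by (simp_all add: card_peak_slots)

section \<open>Inserting the largest letter\<close>

lemma insert_cycle_permutes:
  assumes "k \<le> n"
  shows "insert_cycle n k permutes {1..n+1}"
proof (rule bij_imp_permutes)
  show "bij_betw (insert_cycle n k) {1..n+1} {1..n+1}"
    by (rule bij_betw_byWitness[where f' = "\<lambda>j. if j \<le> k then j else if j \<le> n then j + 1 else k + 1"])
       (use assms in \<open>auto simp: insert_cycle_def\<close>)
qed (use assms in \<open>auto simp: insert_cycle_def\<close>)

lemma permutes_Suc_last_fixed:
  fixes \<sigma> :: "nat \<Rightarrow> nat"
  assumes "\<sigma> permutes {1..n+1}" "\<sigma> (n + 1) = n + 1"
  shows "\<sigma> permutes {1..n}"
proof (rule permutes_superset[OF assms(1)])
  fix x assume "x \<in> {1..n+1} - {1..n}"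
  then have "x = n + 1" by auto
  then show "\<sigma> x = x" using assms(2) by simp
qed

lemma bij_betw_insert_cycle:
  assumes "k \<le> n"
  shows "bij_betw (\<lambda>\<pi>. \<pi> \<circ> insert_cycle n k) {\<pi>. \<pi> permutes {1..n}}
           {\<sigma>. \<sigma> permutes {1..n+1} \<and> \<sigma> (k + 1) = n + 1}"
proof -
  let ?c = "insert_cycle n k"
  note c = insert_cycle_permutes[OF assms]
  have ck: "?c (k + 1) = n + 1" by (simp add: insert_cycle_def)
  have ick: "inv ?c (n + 1) = k + 1" using permutes_inverses(2)[OF c] ck by metis
  have to: "\<pi> \<circ> ?c permutes {1..n+1} \<and> (\<pi> \<circ> ?c) (k + 1) = n + 1" if "\<pi> permutes {1..n}" for \<pi>
  proof -
    have "\<pi> permutes {1..n+1}" by (rule permutes_subset[OF that]) auto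
    moreover have "\<pi> (n + 1) = n + 1" using permutes_not_in[OF that] by simp
    ultimately show ?thesis using permutes_compose[OF c] ck by simp
  qed
  have from': "\<sigma> \<circ> inv ?c permutes {1..n}" if "\<sigma> permutes {1..n+1}" "\<sigma> (k + 1) = n + 1" for \<sigma>
    by (rule permutes_Suc_last_fixed) (use that permutes_compose[OF permutes_inv[OF c]] ick in auto)
  show ?thesis
    by (rule bij_betw_byWitness[where f' = "\<lambda>\<sigma>. \<sigma> \<circ> inv ?c"])
       (use to from' permutes_inv_o[OF c] in \<open>auto simp: comp_assoc\<close>)
qed

lemma sum_permutes_Suc:
  fixes g :: "(nat \<Rightarrow> nat) \<Rightarrow> 'a :: comm_monoid_add"
  shows "(\<Sum>\<sigma> | \<sigma> permutes {1..n+1}. g \<sigma>) =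
           (\<Sum>\<pi> | \<pi> permutes {1..n}. \<Sum>k\<le>n. g (\<pi> \<circ> insert_cycle n k))"
proof -
  let ?P = "\<lambda>k. {\<sigma>. \<sigma> permutes {1..n+1} \<and> \<sigma> (k + 1) = n + 1}"
  have fin: "finite {\<sigma>. \<sigma> permutes {1..n+1}}" by (rule finite_permutations) simp
  have eq: "{\<sigma>. \<sigma> permutes {1..n+1}} = (\<Union>k\<in>{..n}. ?P k)"
  proof -
    have "\<exists>k\<le>n. \<sigma> (k + 1) = n + 1" if "\<sigma> permutes {1..n+1}" for \<sigma>
    proof -
      have "inv \<sigma> (n + 1) \<in> {1..n+1}" using permutes_in_image[OF permutes_inv[OF that], of "n+1"] by simp
      moreover have "\<sigma> (inv \<sigma> (n + 1)) = n + 1" using permutes_inverses(1)[OF that] by simp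
      ultimately show ?thesis by (intro exI[of _ "inv \<sigma> (n + 1) - 1"]) auto
    qed
    then show ?thesis by auto
  qed
  have "(\<Sum>\<sigma> | \<sigma> permutes {1..n+1}. g \<sigma>) = (\<Sum>k\<le>n. \<Sum>\<sigma>\<in>?P k. g \<sigma>)"
    unfolding eq
  proof (rule sum.UNION_disjoint)
    show "\<forall>k\<in>{..n}. finite (?P k)" using finite_subset[OF _ fin] by auto
    show "\<forall>i\<in>{..n}. \<forall>j\<in>{..n}. i \<noteq> j \<longrightarrow> ?P i \<inter> ?P j = {}"
    proof (intro ballI impI)
      fix i j :: nat assume "i \<noteq> j"
      have False if "\<sigma> permutes {1..n+1}" "\<sigma> (i + 1) = n + 1" "\<sigma> (j + 1) = n + 1" for \<sigma>
        using injD[OF permutes_inj[OF that(1)], of "i+1" "j+1"] that \<open>i \<noteq> j\<close> by simp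
      then show "?P i \<inter> ?P j = {}" by blast
    qed
  qed simp
  also have "\<dots> = (\<Sum>k\<le>n. \<Sum>\<pi> | \<pi> permutes {1..n}. g (\<pi> \<circ> insert_cycle n k))"
    by (intro sum.cong refl sum.reindex_bij_betw[symmetric] bij_betw_insert_cycle) simp
  also have "\<dots> = (\<Sum>\<pi> | \<pi> permutes {1..n}. \<Sum>k\<le>n. g (\<pi> \<circ> insert_cycle n k))"
    by (rule sum.swap)
  finally show ?thesis .
qed

lemma permutes_le:
  fixes \<pi> :: "nat \<Rightarrow> nat"
  assumes "\<pi> permutes {1..n}" "i \<le> n"
  shows "\<pi> i \<le> n"
proof (cases "i = 0")
  case True
  then show ?thesis using permutes_not_in[OF assms(1), of 0] by simp
next
  case False
  then show ?thesis using permutes_in_image[OF assms(1), of i] assms(2) by simp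
qed

text \<open>The new letter beats both neighbours, so it is a peak unless it stands last, and the old
  letters at positions \<open>k\<close> and \<open>k + 1\<close> cease to be peaks. All other
  comparisons survive, shifted by one to the right of the slot.\<close>

lemma peaks_insert:
  assumes "\<pi> permutes {1..n}" "k \<le> n"
  shows "peaks (n + 1) (\<pi> \<circ> insert_cycle n k) =
           (\<lambda>i. if i \<le> k then i else i + 1) ` (peaks n \<pi> - {k, k + 1}) \<union> (if k < n then {k + 1} else {})"
    (is "?L = ?f ` ?A \<union> ?B")
proof -
  let ?s = "\<pi> \<circ> insert_cycle n k"
  have s1: "?s i = \<pi> i" if "i \<le> k" for i using that by (simp add: insert_cycle_def)
  have s2: "?s (k + 1) = n + 1"
    using permutes_not_in[OF assms(1), of "n+1"] by (simp add: insert_cycle_def)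
  have s3: "?s i = \<pi> (i - 1)" if "k + 1 < i" "i \<le> n + 1" for i
    using that by (simp add: insert_cycle_def)
  have le: "\<pi> i < n + 1" if "i \<le> n" for i using permutes_le[OF assms(1) that] by simp
  have low: "i \<in> ?L \<longleftrightarrow> i \<in> peaks n \<pi>" if "i < k" for i
    using that assms(2) by (auto simp: peaks_def s1 simp del: o_apply)
  have kk: "k \<notin> ?L"
  proof
    assume "k \<in> ?L"
    then have "?s k > ?s (k + 1)" by (simp add: peaks_def)
    then show False using s1[of k] s2 le[OF assms(2)] by simp
  qed
  have k1: "k + 1 \<in> ?L \<longleftrightarrow> k < n"
  proof (cases "k < n")
    case True
    have "?s k < ?s (k + 1)" using s1[of k] s2 le[OF assms(2)] by simp
    moreover have "?s (k + 1 + 1) < ?s (k + 1)" using s3[of "k+1+1"] s2 le[of "k+1"] True by simp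
    ultimately show ?thesis using True by (simp add: peaks_def del: o_apply)
  qed (simp add: peaks_def)
  have k2: "k + 2 \<notin> ?L"
  proof
    assume a: "k + 2 \<in> ?L"
    then have "k + 2 \<le> n" "?s (k + 1) < ?s (k + 2)" by (simp_all add: peaks_def)
    then show False using s2 s3[of "k+2"] le[of "k+1"] by simp
  qed
  have high: "i + 1 \<in> ?L \<longleftrightarrow> i \<in> peaks n \<pi>" if "k + 1 < i" for i
  proof (cases "i < n")
    case True
    have "?s i = \<pi> (i - 1)" "?s (i + 1) = \<pi> i" "?s (i + 2) = \<pi> (i + 1)"
      using s3[of i] s3[of "i+1"] s3[of "i+2"] that True by simp_all
    then show ?thesis using True that by (auto simp: peaks_def simp del: o_apply)
  qed (auto simp: peaks_def)
  show ?thesis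
  proof (rule set_eqI)
    fix j
    consider "j < k" | "j = k" | "j = k + 1" | "j = k + 2" | "j = (j - 1) + 1" "k + 1 < j - 1"
      by linarith
    then show "j \<in> ?L \<longleftrightarrow> j \<in> ?f ` ?A \<union> ?B"
    proof cases
      case 1 then show ?thesis using low[of j] by (auto simp: image_iff)
    next
      case 2 then show ?thesis using kk by (auto simp: image_iff)
    next
      case 3 then show ?thesis using k1 by (auto simp: image_iff)
    next
      case 4 then show ?thesis using k2 by (auto simp: image_iff)
    next
      case 5
      then have "j \<in> ?L \<longleftrightarrow> j - 1 \<in> peaks n \<pi>" using high[of "j - 1"] by simp
      moreover have "j \<in> ?f ` ?A \<union> ?B \<longleftrightarrow> j - 1 \<in> peaks n \<pi>"
        using 5 by (auto simp: image_iff intro!: bexI[of _ "j - 1"])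
      ultimately show ?thesis by simp
    qed
  qed
qed

lemma lpk_insert:
  assumes "\<pi> permutes {1..n}" "k \<le> n"
  shows "lpk (n + 1) (\<pi> \<circ> insert_cycle n k) =
           (if k = n then lpk n \<pi> else if k \<in> peak_slots n \<pi> then lpk n \<pi> else lpk n \<pi> + 1)"
proof -
  let ?P = "peaks n \<pi>" and ?f = "\<lambda>i. if i \<le> k then i else i + 1"
  have inj: "inj_on ?f A" for A by (auto simp: inj_on_def)
  have "lpk (n + 1) (\<pi> \<circ> insert_cycle n k) = card (?f ` (?P - {k, k + 1})) + (if k < n then 1 else 0)"
    unfolding lpk_eq_card_peaks peaks_insert[OF assms]
    by (subst card_Un_disjoint) auto
  also have "\<dots> = card (?P - {k, k + 1}) + (if k < n then 1 else 0)"
    by (simp only: card_image[OF inj])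
  also have "card (?P - {k, k + 1}) = (if k \<in> peak_slots n \<pi> then lpk n \<pi> - 1 else lpk n \<pi>)"
  proof -
    consider "k \<in> ?P" "k + 1 \<notin> ?P" | "k \<notin> ?P" "k + 1 \<in> ?P" | "k \<notin> ?P" "k + 1 \<notin> ?P"
      using peaks_not_adjacent[of k n \<pi>] by auto
    then show ?thesis
    proof cases
      case 1
      then have "?P - {k, k + 1} = ?P - {k}" by auto
      with 1 show ?thesis by (simp add: lpk_eq_card_peaks peak_slots_def)
    next
      case 2
      then have "?P - {k, k + 1} = ?P - {k + 1}" by auto
      with 2 show ?thesis by (simp add: lpk_eq_card_peaks peak_slots_def)
    next
      case 3
      then have "?P - {k, k + 1} = ?P" by auto
      with 3 show ?thesis by (simp add: lpk_eq_card_peaks peak_slots_def)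
    qed
  qed
  finally have main: "lpk (n + 1) (\<pi> \<circ> insert_cycle n k) =
    (if k \<in> peak_slots n \<pi> then lpk n \<pi> - 1 else lpk n \<pi>) + (if k < n then 1 else 0)" .
  show ?thesis
  proof (cases "k \<in> peak_slots n \<pi>")
    case True
    then have "k < n" using peak_slots_subset(1)[of n \<pi>] by auto
    \<comment> \<open>A peak slot has a peak beside it, so the truncated subtraction in
      \<open>main\<close> is a genuine one.\<close>
    moreover have "lpk n \<pi> > 0"
      using True by (auto simp: lpk_eq_card_peaks card_gt_0_iff peak_slots_def)
    ultimately show ?thesis using True main by simp
  qed (use main assms in auto)
qed

text \<open>With l = \<open>lpk n \<pi>\<close>, 2l of the \<open>N\<close> slots keep the exponent
  and N - 2l raise it: 2l x^l + (N - 2l) x^(l+1) = N x x^l + 2x(1 - x) l x^(l-1). This is where the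
  derivative comes from. \<open>N\<close> will be \<open>n\<close> after a final descent and
  \<open>n - 1\<close> after a final ascent.\<close>

lemma sum_insert_monom:
  assumes "\<pi> permutes {1..n}" "N \<le> n" "peak_slots n \<pi> \<subseteq> {..<N}"
  shows "(\<Sum>k<N. monom (1::real) (lpk (n + 1) (\<pi> \<circ> insert_cycle n k))) =
           of_nat N * [:0, 1:] * monom 1 (lpk n \<pi>)
             + 2 * [:0, 1:] * (1 - [:0, 1:]) * pderiv (monom 1 (lpk n \<pi>))"
proof -
  let ?D = "peak_slots n \<pi>" and ?l = "lpk n \<pi>"
  have card_le: "2 * ?l \<le> N"
    using card_mono[OF _ assms(3)] by (simp add: card_peak_slots)
  have "(\<Sum>k<N. monom (1::real) (lpk (n + 1) (\<pi> \<circ> insert_cycle n k))) =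
        (\<Sum>k<N. if k \<in> ?D then monom 1 ?l else monom 1 (?l + 1))"
    by (intro sum.cong refl) (use assms lpk_insert[OF assms(1)] in auto)
  also have "\<dots> = of_nat (2 * ?l) * monom 1 ?l + of_nat (N - 2 * ?l) * monom 1 (?l + 1)"
  proof -
    have "{..<N} \<inter> {k. k \<in> ?D} = ?D" "{..<N} \<inter> - {k. k \<in> ?D} = {..<N} - ?D" using assms(3) by auto
    then show ?thesis
      by (simp add: sum.If_cases card_Diff_subset[OF card_peak_slots(1) assms(3)] card_peak_slots)
  qed
  also have "\<dots> = of_nat N * [:0, 1:] * monom 1 ?l + 2 * [:0, 1:] * (1 - [:0, 1:]) * pderiv (monom 1 ?l)"
  proof (cases ?l)
    case 0
    then show ?thesis by (simp add: monom_Suc pderiv_monom)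
  next
    case (Suc m)
    have X: "monom (1::real) (Suc i) = [:0, 1:] * monom 1 i" for i by (simp add: monom_Suc)
    have d: "pderiv (monom (1::real) (Suc m)) = of_nat (Suc m) * monom 1 m"
      by (simp add: pderiv_monom of_nat_monom mult_monom)
    have c: "(of_nat (N - 2 * Suc m) :: real poly) = of_nat N - 2 * of_nat (Suc m)"
      using card_le Suc by (simp add: of_nat_diff)
    show ?thesis unfolding Suc d
      unfolding add_Suc_right add_0_right One_nat_def X c
      by (simp only: of_nat_mult of_nat_numeral) algebra
  qed
  finally show ?thesis .
qed

section \<open>Summation over all insertions\<close>

lemma S_plus_S_minus_partition:
  assumes "n \<ge> 1"
  shows "{\<pi>. \<pi> permutes {1..n}} = S_plus n \<union> S_minus n" "S_plus n \<inter> S_minus n = {}"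
    "finite (S_plus n)" "finite (S_minus n)"
proof -
  have "\<pi> (n - 1) \<noteq> \<pi> n" if "\<pi> permutes {1..n}" for \<pi>
    using injD[OF permutes_inj[OF that], of "n-1" n] assms by auto
  then show "{\<pi>. \<pi> permutes {1..n}} = S_plus n \<union> S_minus n"
    unfolding S_plus_def S_minus_def using linorder_neq_iff by blast
  then show "finite (S_plus n)" "finite (S_minus n)"
    using finite_permutations[of "{1..n}"] by simp_all
  show "S_plus n \<inter> S_minus n = {}" by (auto simp: S_plus_def S_minus_def)
qed

text \<open>Slot \<open>n\<close> makes the new letter last, creating a final ascent; slot
  \<open>n - 1\<close> puts it just before the last letter, creating a final descent; earlier slots
  leave the last two letters alone.\<close>

lemma insert_in_S_iff:
  assumes "\<pi> permutes {1..n}" "k \<le> n" "n \<ge> 1"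
  shows "\<pi> \<circ> insert_cycle n k \<in> S_plus (n + 1) \<longleftrightarrow> k = n - 1 \<or> k < n - 1 \<and> \<pi> \<in> S_plus n"
    and "\<pi> \<circ> insert_cycle n k \<in> S_minus (n + 1) \<longleftrightarrow> k = n \<or> k < n - 1 \<and> \<pi> \<in> S_minus n"
proof -
  let ?s = "\<pi> \<circ> insert_cycle n k"
  have p: "?s permutes {1..n+1}"
    using bij_betw_apply[OF bij_betw_insert_cycle[OF assms(2)], of \<pi>] assms(1) by blast
  have last: "\<pi> (Suc n) = Suc n" using permutes_not_in[OF assms(1), of "n+1"] by simp
  have le: "\<pi> n \<le> n" using permutes_le[OF assms(1)] by simp
  consider "k = n" | "k = n - 1" "k \<noteq> n" | "k < n - 1" using assms by linarith
  then have "(?s n > ?s (n + 1) \<longleftrightarrow> k = n - 1 \<or> k < n - 1 \<and> \<pi> (n - 1) > \<pi> n) \<and>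
             (?s n < ?s (n + 1) \<longleftrightarrow> k = n \<or> k < n - 1 \<and> \<pi> (n - 1) < \<pi> n)"
    by cases (use assms last le in \<open>auto simp: insert_cycle_def\<close>)
  then show "?s \<in> S_plus (n + 1) \<longleftrightarrow> k = n - 1 \<or> k < n - 1 \<and> \<pi> \<in> S_plus n"
    and "?s \<in> S_minus (n + 1) \<longleftrightarrow> k = n \<or> k < n - 1 \<and> \<pi> \<in> S_minus n"
    using p assms(1) by (simp_all add: S_plus_def S_minus_def del: o_apply)
qed

lemma pderiv_sum: "pderiv (sum f A) = (\<Sum>x\<in>A. pderiv (f x))"
  using higher_pderiv_sum[of 1 f A] by simp

text \<open>A word with a final descent admits all slots below \<open>n\<close>. A word with a final
  ascent admits only slot \<open>n - 1\<close>, which touches no peak and so contributes a factor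
  x.\<close>

lemma T_E_Suc:
  assumes "n \<ge> 1"
  shows "T_E (n + 1) = of_nat n * [:0, 1:] * T_E n
           + 2 * [:0, 1:] * (1 - [:0, 1:]) * pderiv (T_E n) + [:0, 1:] * T_O n"
proof -
  let ?w = "\<lambda>\<pi> k. monom (1::real) (lpk (n + 1) (\<pi> \<circ> insert_cycle n k))"
  \<comment> \<open>Extension by zero allows the sum to run over all permutations, as
    \<open>sum_permutes_Suc\<close> requires.\<close>
  let ?g = "\<lambda>\<sigma>. if \<sigma> \<in> S_plus (n + 1) then monom (1::real) (lpk (n + 1) \<sigma>) else 0"
  note part = S_plus_S_minus_partition[OF assms]
  have fin: "finite {\<sigma>. \<sigma> permutes {1..n+1}}" by (rule finite_permutations) simp
  have sub: "S_plus (n + 1) \<subseteq> {\<sigma>. \<sigma> permutes {1..n+1}}" by (auto simp: S_plus_def)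
  have perm: "\<pi> permutes {1..n}" if "\<pi> \<in> S_plus n \<or> \<pi> \<in> S_minus n" for \<pi>
    using that by (auto simp: S_plus_def S_minus_def)
  have plus: "(\<Sum>k\<le>n. ?g (\<pi> \<circ> insert_cycle n k)) = of_nat n * [:0, 1:] * monom 1 (lpk n \<pi>)
           + 2 * [:0, 1:] * (1 - [:0, 1:]) * pderiv (monom 1 (lpk n \<pi>))"
    if "\<pi> \<in> S_plus n" for \<pi>
  proof -
    have "(\<Sum>k\<le>n. ?g (\<pi> \<circ> insert_cycle n k)) = (\<Sum>k<n. ?w \<pi> k)"
      by (rule sum.mono_neutral_cong_right)
         (use insert_in_S_iff(1)[OF perm] that assms in auto)
    then show ?thesis using sum_insert_monom[OF perm _ peak_slots_subset(1), of \<pi>] that by simp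
  qed
  have minus: "(\<Sum>k\<le>n. ?g (\<pi> \<circ> insert_cycle n k)) = [:0, 1:] * monom 1 (lpk n \<pi>)"
    if "\<pi> \<in> S_minus n" for \<pi>
  proof -
    have np: "\<pi> \<notin> S_plus n" using that part(2) by auto
    have "(\<Sum>k\<le>n. ?g (\<pi> \<circ> insert_cycle n k)) = (\<Sum>k\<in>{n-1}. ?w \<pi> k)"
      by (rule sum.mono_neutral_cong_right)
         (use insert_in_S_iff(1)[OF perm] that assms np in auto)
    also have "n - 1 \<notin> peak_slots n \<pi>"
      using peak_slots_subset(2)[of \<pi> n] that by (auto simp: S_minus_def)
    then have "(\<Sum>k\<in>{n-1}. ?w \<pi> k) = [:0, 1:] * monom 1 (lpk n \<pi>)"
      using lpk_insert[OF perm, of \<pi> "n-1"] that assms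
      by (cases n) (simp_all add: monom_Suc)
    finally show ?thesis .
  qed
  have "T_E (n + 1) = (\<Sum>\<sigma> | \<sigma> permutes {1..n+1}. ?g \<sigma>)"
    unfolding T_E_def using fin sub by (simp add: sum.If_cases Int_absorb1)
  also have "\<dots> = (\<Sum>\<pi>\<in>S_plus n. \<Sum>k\<le>n. ?g (\<pi> \<circ> insert_cycle n k)) +
                 (\<Sum>\<pi>\<in>S_minus n. \<Sum>k\<le>n. ?g (\<pi> \<circ> insert_cycle n k))"
    unfolding sum_permutes_Suc part(1) by (rule sum.union_disjoint) (use part in auto)
  also have "\<dots> = (\<Sum>\<pi>\<in>S_plus n. of_nat n * [:0, 1:] * monom 1 (lpk n \<pi>)
           + 2 * [:0, 1:] * (1 - [:0, 1:]) * pderiv (monom 1 (lpk n \<pi>))) +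
             (\<Sum>\<pi>\<in>S_minus n. [:0, 1:] * monom 1 (lpk n \<pi>))"
    by (intro arg_cong2[where f = "(+)"] sum.cong refl plus minus)
  also have "\<dots> = of_nat n * [:0, 1:] * T_E n
           + 2 * [:0, 1:] * (1 - [:0, 1:]) * pderiv (T_E n) + [:0, 1:] * T_O n"
    by (simp only: T_E_def T_O_def sum.distrib sum_distrib_left pderiv_sum)
  finally show ?thesis .
qed

text \<open>Slot \<open>n\<close> is admissible for every word and keeps \<open>lpk\<close>, giving
  \<open>T_O n + T_E n\<close>. The slots below \<open>n - 1\<close> count only after a final
  ascent, and then all peak slots are among them.\<close>

lemma T_O_Suc:
  assumes "n \<ge> 1"
  shows "T_O (n + 1) = ((of_nat n - 1) * [:0, 1:] + 1) * T_O n
           + 2 * [:0, 1:] * (1 - [:0, 1:]) * pderiv (T_O n) + T_E n"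
proof -
  let ?w = "\<lambda>\<pi> k. monom (1::real) (lpk (n + 1) (\<pi> \<circ> insert_cycle n k))"
  let ?g = "\<lambda>\<sigma>. if \<sigma> \<in> S_minus (n + 1) then monom (1::real) (lpk (n + 1) \<sigma>) else 0"
  note part = S_plus_S_minus_partition[OF assms]
  have fin: "finite {\<sigma>. \<sigma> permutes {1..n+1}}" by (rule finite_permutations) simp
  have sub: "S_minus (n + 1) \<subseteq> {\<sigma>. \<sigma> permutes {1..n+1}}" by (auto simp: S_minus_def)
  have perm: "\<pi> permutes {1..n}" if "\<pi> \<in> S_plus n \<or> \<pi> \<in> S_minus n" for \<pi>
    using that by (auto simp: S_plus_def S_minus_def)
  have plus: "(\<Sum>k\<le>n. ?g (\<pi> \<circ> insert_cycle n k)) = monom 1 (lpk n \<pi>)" if "\<pi> \<in> S_plus n" for \<pi>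
  proof -
    have nm: "\<pi> \<notin> S_minus n" using that part(2) by auto
    have "(\<Sum>k\<le>n. ?g (\<pi> \<circ> insert_cycle n k)) = (\<Sum>k\<in>{n}. ?w \<pi> k)"
      by (rule sum.mono_neutral_cong_right)
         (use insert_in_S_iff(2)[OF perm] that assms nm in auto)
    then show ?thesis using lpk_insert[OF perm, of \<pi> n] that by simp
  qed
  have minus: "(\<Sum>k\<le>n. ?g (\<pi> \<circ> insert_cycle n k)) =
      ((of_nat n - 1) * [:0, 1:] * monom 1 (lpk n \<pi>)
        + 2 * [:0, 1:] * (1 - [:0, 1:]) * pderiv (monom 1 (lpk n \<pi>))) + monom 1 (lpk n \<pi>)"
    if "\<pi> \<in> S_minus n" for \<pi>
  proof -
    have slots: "peak_slots n \<pi> \<subseteq> {..<n-1}"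
      using peak_slots_subset(2)[of \<pi> n] that by (auto simp: S_minus_def)
    have "(\<Sum>k\<le>n. ?g (\<pi> \<circ> insert_cycle n k)) = (\<Sum>k\<in>insert n {..<n-1}. ?w \<pi> k)"
      by (rule sum.mono_neutral_cong_right)
         (use insert_in_S_iff(2)[OF perm] that assms in auto)
    also have "\<dots> = (\<Sum>k<n-1. ?w \<pi> k) + monom 1 (lpk n \<pi>)"
      using lpk_insert[OF perm, of \<pi> n] that by (simp add: add.commute)
    also have "(\<Sum>k<n-1. ?w \<pi> k) = of_nat (n - 1) * [:0, 1:] * monom 1 (lpk n \<pi>)
        + 2 * [:0, 1:] * (1 - [:0, 1:]) * pderiv (monom 1 (lpk n \<pi>))"
      by (rule sum_insert_monom[OF perm _ slots]) (use that in auto)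
    also have "(of_nat (n - 1) :: real poly) = of_nat n - 1" using assms by (simp add: of_nat_diff)
    finally show ?thesis .
  qed
  have "T_O (n + 1) = (\<Sum>\<sigma> | \<sigma> permutes {1..n+1}. ?g \<sigma>)"
    unfolding T_O_def using fin sub by (simp add: sum.If_cases Int_absorb1)
  also have "\<dots> = (\<Sum>\<pi>\<in>S_plus n. \<Sum>k\<le>n. ?g (\<pi> \<circ> insert_cycle n k)) +
                 (\<Sum>\<pi>\<in>S_minus n. \<Sum>k\<le>n. ?g (\<pi> \<circ> insert_cycle n k))"
    unfolding sum_permutes_Suc part(1) by (rule sum.union_disjoint) (use part in auto)
  also have "\<dots> = (\<Sum>\<pi>\<in>S_plus n. monom 1 (lpk n \<pi>)) +
      (\<Sum>\<pi>\<in>S_minus n. ((of_nat n - 1) * [:0, 1:] * monom 1 (lpk n \<pi>)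
        + 2 * [:0, 1:] * (1 - [:0, 1:]) * pderiv (monom 1 (lpk n \<pi>))) + monom 1 (lpk n \<pi>))"
    by (intro arg_cong2[where f = "(+)"] sum.cong refl plus minus)
  also have "\<dots> = T_E n + (((of_nat n - 1) * [:0, 1:] * T_O n
        + 2 * [:0, 1:] * (1 - [:0, 1:]) * pderiv (T_O n)) + T_O n)"
    by (simp only: T_E_def T_O_def sum.distrib sum_distrib_left pderiv_sum)
  finally show ?thesis by (simp only: distrib_right mult_1_left add_ac)
qed

lemma S_1: "S_plus 1 = {}" "S_minus 1 = {id}"
proof -
  have "{\<pi>. \<pi> permutes {1..1::nat}} = {id}" using permutes_sing by auto
  then show "S_plus 1 = {}" "S_minus 1 = {id}"
    by (auto simp: S_plus_def S_minus_def set_eq_iff)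
qed

lemma T_1: "T_E 1 = 0" "T_O 1 = 1"
  unfolding T_E_def T_O_def S_1 by (simp_all add: lpk_def)

lemma degree_T_le: "degree (T_E n) \<le> n div 2" "degree (T_O n) \<le> (n - 1) div 2"
proof -
  show "degree (T_E n) \<le> n div 2" unfolding T_E_def
  proof (rule degree_sum_le)
    show "finite (S_plus n)"
      using finite_subset[OF _ finite_permutations[of "{1..n}"]] by (auto simp: S_plus_def)
  next
    fix \<pi> show "degree (monom (1::real) (lpk n \<pi>)) \<le> n div 2" 
      using lpk_le(1)[of n \<pi>] by (intro order_trans[OF degree_monom_le]) simp
  qed
  show "degree (T_O n) \<le> (n - 1) div 2" unfolding T_O_def
  proof (rule degree_sum_le)
    show "finite (S_minus n)"
      using finite_subset[OF _ finite_permutations[of "{1..n}"]] by (auto simp: S_minus_def)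
    fix \<pi> assume "\<pi> \<in> S_minus n"
    then show "degree (monom (1::real) (lpk n \<pi>)) \<le> (n - 1) div 2" 
      using lpk_le(2)[of \<pi> n] by (intro order_trans[OF degree_monom_le]) (auto simp: S_minus_def)
  qed
qed

lemma coeff_T_nonneg: "coeff (T_E n) i \<ge> 0" "coeff (T_O n) i \<ge> 0"
  unfolding T_E_def T_O_def by (simp_all add: coeff_sum sum_nonneg)

section \<open>Passage from real to complex polynomials\<close>

lemma map_poly_of_real_add:
  "map_poly complex_of_real (p + q) = map_poly complex_of_real p + map_poly complex_of_real q"
  by (rule poly_eqI) (simp add: coeff_map_poly)

lemma map_poly_of_real_mult:
  "map_poly complex_of_real (p * q) = map_poly complex_of_real p * map_poly complex_of_real q"
  by (rule poly_eqI) (simp add: coeff_map_poly coeff_mult)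

lemma map_poly_of_real_pderiv:
  "map_poly complex_of_real (pderiv p) = pderiv (map_poly complex_of_real p)"
  by (rule poly_eqI) (simp add: coeff_map_poly coeff_pderiv)

lemma map_poly_of_real_pcompose:
  "map_poly complex_of_real (pcompose p q) =
     pcompose (map_poly complex_of_real p) (map_poly complex_of_real q)"
  by (induction p)
     (simp_all add: pcompose_pCons map_poly_pCons map_poly_of_real_add map_poly_of_real_mult)

lemma poly_map_poly_of_real:
  "poly (map_poly complex_of_real p) (of_real x) = of_real (poly p x)"
  by (induction p) (simp_all add: map_poly_pCons)

section \<open>Location of the zeros of the combined polynomial\<close>

text \<open>For \<open>n \<ge> 1\<close> this counts permutations by the monotone runs of the word 0
  \<open>\<pi>(1)\<close> ... \<open>\<pi>(n)\<close>: there are 2 lpk runs if it ends in a descent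
  and 2 lpk + 1 if it ends in an ascent.\<close>

definition run_poly :: "nat \<Rightarrow> real poly" where
  "run_poly n = pcompose (T_E n) [:0, 0, 1:] + [:0, 1:] * pcompose (T_O n) [:0, 0, 1:]"

lemma run_poly_1: "run_poly 1 = [:0, 1:]"
  unfolding run_poly_def T_1 by (simp add: pcompose_1)

text \<open>Under the substitution of x^2 the operator 2x(1 - x) d/dx becomes x(1 - x^2) d/dx.
  Differentiating the factor x in front of the odd part accounts for the coefficient (n - 1)x + 1 in
  place of nx.\<close>

lemma run_poly_Suc:
  assumes "n \<ge> 1"
  shows "run_poly (n + 1) =
           [:0, 1, real n:] * run_poly n + [:0, 1, 0, -1:] * pderiv (run_poly n)"
proof -
  have "poly (run_poly (n + 1)) x = poly ([:0, 1, real n:] * run_poly n + [:0, 1, 0, -1:] * pderiv (run_poly n)) x" for x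
    unfolding run_poly_def T_E_Suc[OF assms] T_O_Suc[OF assms]
    by (simp add: poly_pcompose pderiv_add pderiv_mult pderiv_pcompose pderiv_pCons)
       (simp add: algebra_simps)
  then show ?thesis by (intro poly_ext)
qed

text \<open>These values make 0 a simple zero of \<open>run_poly n\<close> and show that
  \<open>T_O n\<close> is nonzero.\<close>

lemma poly_T_0:
  assumes "n \<ge> 1"
  shows "poly (T_E n) 0 = 0" "poly (T_O n) 0 = 1"
proof -
  have "poly (T_E n) 0 = 0 \<and> poly (T_O n) 0 = 1" using assms
  proof (induction n rule: dec_induct)
    case base
    then show ?case using T_1 by simp
  next
    case (step n)
    then show ?case using T_E_Suc[of n] T_O_Suc[of n] by simp
  qed
  then show "poly (T_E n) 0 = 0" "poly (T_O n) 0 = 1" by auto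
qed

lemma T_E_nonzero:
  assumes "n \<ge> 2"
  shows "T_E n \<noteq> 0"
proof -
  \<comment> \<open>Differentiating the recurrence at 0 sends the value a of this derivative to 2a +
    1.\<close>
  have "poly (pderiv (T_E n)) 0 > 0" using assms
  proof (induction n rule: dec_induct)
    case base
    then show ?case using T_E_Suc[of 1] T_1 by (simp add: numeral_2_eq_2 pderiv_pCons)
  next
    case (step n)
    then show ?case using T_E_Suc[of n] poly_T_0[of n]
      by (simp add: pderiv_add pderiv_mult pderiv_pCons pderiv_diff)
  qed
  then show ?thesis by auto
qed

lemma coeff_pcompose_square_nonneg:
  fixes p :: "real poly"
  assumes "\<And>i. coeff p i \<ge> 0"
  shows "coeff (pcompose p [:0, 0, 1:]) i \<ge> 0"
  using assms
proof (induction p arbitrary: i)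
  case (pCons a p)
  have "a \<ge> 0" using pCons.prems[of 0] by simp
  moreover have "coeff p i \<ge> 0" for i using pCons.prems[of "Suc i"] by simp
  ultimately show ?case using pCons.IH
    by (auto simp: pcompose_pCons coeff_pCons split: nat.splits)
qed simp

lemma degree_run_poly:
  assumes "n \<ge> 1"
  shows "degree (run_poly n) = n"
proof -
  have le: "degree (run_poly n) \<le> n" if "n \<ge> 1" for n
  proof -
    have "degree (pcompose (T_E n) [:0, 0, 1:]) \<le> n"
      using degree_T_le(1)[of n] by (simp add: degree_pcompose)
    moreover have "degree ([:0, 1:] * pcompose (T_O n) [:0, 0, 1:]) \<le> n"
      by (rule order_trans[OF degree_mult_le]) (use degree_T_le(2)[of n] that in \<open>simp add: degree_pcompose\<close>)
    ultimately show ?thesis unfolding run_poly_def by (rule degree_add_le)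
  qed
  have nonneg: "coeff (run_poly n) i \<ge> 0" for n i
    unfolding run_poly_def
    using coeff_pcompose_square_nonneg[OF coeff_T_nonneg(1)] coeff_pcompose_square_nonneg[OF coeff_T_nonneg(2)]
    by (auto simp: coeff_pCons split: nat.splits)
  have "coeff (run_poly n) n > 0" using assms
  proof (induction n rule: dec_induct)
    case base
    then show ?case using run_poly_1 by simp
  next
    case (step n)
    then obtain m where m: "n = Suc m" by (cases n) auto
    have "coeff (run_poly n) (Suc n) = 0" using le[OF step.hyps(1)] by (intro coeff_eq_0) simp
    \<comment> \<open>The coefficient at \<open>m\<close> = n - 1 enters with factor n from the
      product and -(n - 1) from the derivative term. Nonnegativity then keeps the sum
      positive.\<close>
    then have "coeff (run_poly (n + 1)) (n + 1) = coeff (run_poly n) m + coeff (run_poly n) n"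
      unfolding run_poly_Suc[OF step.hyps(1)]
      by (simp add: m coeff_pCons coeff_pderiv algebra_simps split: nat.splits)
    then show ?case using step.IH nonneg[of n m] by simp
  qed
  then have "n \<le> degree (run_poly n)" by (intro le_degree) simp
  with le[OF assms] show ?thesis by simp
qed

text \<open>Giving one summand z to each root turns the expression into a sum of terms z + (1 -
  z^2)/(z - r) = (1 - r z)/(z - r).\<close>

lemma Re_log_derivative_nonneg:
  fixes M :: "complex multiset"
  assumes "\<forall>r\<in>#M. Re r \<le> 0 \<and> r \<noteq> z" "Re z \<ge> 0"
  defines "P \<equiv> \<Prod>r\<in>#M. [:-r, 1:]"
  shows "Re (of_nat (size M) * z + (1 - z\<^sup>2) * (poly (pderiv P) z / poly P z)) \<ge> 0"
  using assms(1) unfolding P_def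
proof (induction M)
  case (add r M)
  let ?P = "\<Prod>r\<in>#M. [:-r, 1:]"
  have nz: "poly ?P z \<noteq> 0" "z - r \<noteq> 0"
    using add.prems by (auto simp: poly_prod_mset)
  have "of_nat (size (add_mset r M)) * z
      + (1 - z\<^sup>2) * (poly (pderiv (\<Prod>r\<in>#add_mset r M. [:-r, 1:])) z / poly (\<Prod>r\<in>#add_mset r M. [:-r, 1:]) z)
      = of_nat (size M) * z + (1 - z\<^sup>2) * (poly (pderiv ?P) z / poly ?P z) + (1 - r * z) / (z - r)"
    using nz by (simp add: pderiv_mult pderiv_pCons field_simps power2_eq_square del: mult_pCons_left)
  moreover have "Re ((1 - r * z) / (z - r)) \<ge> 0"
  proof -
    have "Re r \<le> 0" using add.prems by simp
    \<comment> \<open>Multiplying by the conjugate denominator instead of dividing preserves the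
      sign of the real part.\<close>
    have "Re ((1 - r * z) * cnj (z - r)) = Re z * (1 + (cmod r)\<^sup>2) - Re r * (1 + (cmod z)\<^sup>2)"
      unfolding cmod_power2 by (simp add: algebra_simps power2_eq_square)
    also have "\<dots> \<ge> 0" using \<open>Re r \<le> 0\<close> assms(2)
      by (smt (verit) mult_nonneg_nonneg mult_nonpos_nonneg zero_le_power2)
    finally show ?thesis by (simp add: Re_complex_div_ge_0)
  qed
  ultimately show ?case using add by simp
qed (use assms in simp)

lemma zeros_run_poly:
  assumes "n \<ge> 1" "poly (map_poly complex_of_real (run_poly n)) z = 0" "z \<noteq> 0"
  shows "Re z < 0"
  using assms
proof (induction n arbitrary: z rule: dec_induct)
  case base
  then show ?case using run_poly_1 by (simp add: map_poly_pCons)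
next
  case (step n)
  let ?C = "map_poly complex_of_real (run_poly n)"
  let ?P = "\<Prod>r\<in>#proots ?C. [:-r, 1:]"
  have n0: "run_poly n \<noteq> 0" using degree_run_poly[OF step.hyps(1)] step.hyps(1) by auto
  then have C0: "?C \<noteq> 0" by (simp add: map_poly_eq_0_iff)
  have deg: "degree ?C = n" using degree_run_poly[OF step.hyps(1)] by (simp add: degree_map_poly)
  have C: "?C = smult (lead_coeff ?C) ?P" by (rule complex_poly_decompose_multiset[symmetric])
  show ?case
  proof (rule ccontr)
    assume "\<not> Re z < 0"
    then have z: "Re z \<ge> 0" by simp
    have Cz: "poly ?C z \<noteq> 0" using step.IH[of z] step.prems z by force
    have roots: "Re r \<le> 0 \<and> r \<noteq> z" if "r \<in># proots ?C" for r
    proof -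
      have "poly ?C r = 0" using that C0 by simp
      then show ?thesis using step.IH[of r] Cz by (cases "r = 0") auto
    qed
    \<comment> \<open>The leading coefficient cancels in the logarithmic derivative.\<close>
    have ratio: "poly (pderiv ?C) z / poly ?C z = poly (pderiv ?P) z / poly ?P z"
      by (subst (1 2) C) (use C0 in \<open>simp add: pderiv_smult\<close>)
    have size: "size (proots ?C) = n" using deg by (simp add: size_proots_complex)
    have "poly (map_poly complex_of_real (run_poly (n + 1))) z =
        z * poly ?C z * (1 + (of_nat n * z + (1 - z\<^sup>2) * (poly (pderiv ?C) z / poly ?C z)))"
      unfolding run_poly_Suc[OF step.hyps(1)] map_poly_of_real_add map_poly_of_real_mult
        map_poly_of_real_pderiv
      using Cz by (simp add: map_poly_pCons field_simps power2_eq_square del: mult_pCons_left)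
    with step.prems Cz have "1 + (of_nat n * z + (1 - z\<^sup>2) * (poly (pderiv ?C) z / poly ?C z)) = 0"
      by simp
    then have "Re (of_nat n * z + (1 - z\<^sup>2) * (poly (pderiv ?C) z / poly ?C z)) = -1"
      by (metis add_eq_0_iff uminus_complex.sel(1) one_complex.sel(1) add.commute)
    with Re_log_derivative_nonneg[of "proots ?C" z] roots z ratio size show False by simp
  qed
qed

section \<open>The argument on the imaginary axis\<close>

text \<open>For Re r < 0 each term is the principal argument of iy - r, a point of the right half
  plane. The sum is thus a continuous choice of the argument of the product, free of jumps by 2
  pi.\<close>

definition phase :: "complex multiset \<Rightarrow> real \<Rightarrow> real" where
  "phase M y = (\<Sum>r\<in>#M. arctan ((y - Im r) / (- Re r)))"

lemma prod_eq_cis_phase: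
  assumes "\<forall>r\<in>#M. Re r < 0"
  shows "\<exists>\<rho>>0. (\<Prod>r\<in>#M. \<i> * of_real y - r) = of_real \<rho> * cis (phase M y)"
  using assms
proof (induction M)
  case empty
  then show ?case by (auto simp: phase_def)
next
  case (add r M)
  then obtain \<rho> where \<rho>: "\<rho> > 0" "(\<Prod>r\<in>#M. \<i> * of_real y - r) = of_real \<rho> * cis (phase M y)"
    by auto
  define t where "t = (y - Im r) / (- Re r)"
  have r: "Re r < 0" using add.prems by simp
  have s: "sqrt (1 + t\<^sup>2) > 0" by (simp add: add_pos_nonneg)
  have "of_real (- Re r * sqrt (1 + t\<^sup>2)) * cis (arctan t) = \<i> * of_real y - r"
    using r s by (intro complex_eqI) (simp_all add: cos_arctan sin_arctan t_def)
  then have "(\<Prod>r\<in>#add_mset r M. \<i> * of_real y - r) =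
      of_real (- Re r * sqrt (1 + t\<^sup>2)) * cis (arctan t) * (of_real \<rho> * cis (phase M y))"
    using \<rho>(2) by simp
  also have "\<dots> = of_real (- Re r * sqrt (1 + t\<^sup>2) * \<rho>) * (cis (arctan t) * cis (phase M y))"
    by simp
  also have "cis (arctan t) * cis (phase M y) = cis (phase (add_mset r M) y)"
    by (simp add: phase_def t_def cis_mult)
  finally have "(\<Prod>r\<in>#add_mset r M. \<i> * of_real y - r) =
      of_real (- Re r * sqrt (1 + t\<^sup>2) * \<rho>) * cis (phase (add_mset r M) y)" .
  moreover have "- Re r * sqrt (1 + t\<^sup>2) * \<rho> > 0" using r s \<rho>(1) by (simp add: mult_neg_pos)
  ultimately show ?case by blast
qed

lemma phase_continuous:
  assumes "\<forall>r\<in>#M. Re r < 0"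
  shows "continuous_on UNIV (phase M)"
proof -
  have "continuous_on UNIV (\<lambda>y. phase M y)" using assms
    by (induction M) (auto simp: phase_def intro!: continuous_intros)
  then show ?thesis by simp
qed

lemma phase_strict_mono:
  assumes "\<forall>r\<in>#M. Re r < 0" "M \<noteq> {#}" "x < y"
  shows "phase M x < phase M y"
  using assms(1,2)
proof (induction M)
  case (add r M)
  have "arctan ((x - Im r) / (- Re r)) < arctan ((y - Im r) / (- Re r))"
    using add.prems assms(3) by (intro arctan_monotone divide_strict_right_mono) auto
  moreover have "phase M x \<le> phase M y"
    using add by (cases "M = {#}") (auto simp: phase_def intro: less_imp_le)
  ultimately show ?case by (simp add: phase_def)
qed simp

lemma phase_tendsto:
  assumes "\<forall>r\<in>#M. Re r < 0"
  shows "(phase M \<longlongrightarrow> real (size M) * (pi / 2)) at_top"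
proof -
  have "((\<lambda>y. phase M y) \<longlongrightarrow> real (size M) * (pi / 2)) at_top" using assms
  proof (induction M)
    case (add r M)
    have r: "1 / (- Re r) > 0" using add.prems by simp
    have "filterlim (\<lambda>y. 1 / (- Re r) * (- Im r + y)) at_top at_top"
      by (rule filterlim_tendsto_pos_mult_at_top[OF tendsto_const r])
         (rule filterlim_tendsto_add_at_top[OF tendsto_const filterlim_ident])
    then have "filterlim (\<lambda>y. (y - Im r) / (- Re r)) at_top at_top"
      by (simp add: algebra_simps diff_divide_distrib)
    from filterlim_compose[OF tendsto_arctan_at_top this]
    have "((\<lambda>y. arctan ((y - Im r) / (- Re r)) + phase M y) \<longlongrightarrow> pi / 2 + real (size M) * (pi / 2)) at_top"
      using add by (intro tendsto_add) auto
    then show ?case by (simp add: phase_def distrib_right add_divide_distrib)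
  qed (simp add: phase_def[abs_def])
  then show ?thesis by simp
qed

text \<open>Conjugating the roots negates each arctangent at y = 0, so the phase there equals its
  own negative.\<close>

lemma phase_0:
  assumes "image_mset cnj M = M"
  shows "phase M 0 = 0"
proof -
  have "phase M 0 = phase (image_mset cnj M) 0" by (simp add: assms)
  also have "\<dots> = (\<Sum>r\<in>#M. - arctan ((0 - Im r) / (- Re r)))"
    by (simp add: phase_def multiset.map_comp o_def arctan_minus[symmetric])
  also have "\<dots> = - phase M 0" unfolding phase_def by (induction M) simp_all
  finally show ?thesis by simp
qed

lemma phase_levels:
  assumes M: "\<forall>r\<in>#M. Re r < 0" and cnj: "image_mset cnj M = M"
  obtains y where "y 0 = 0" "\<And>j k. j < k \<Longrightarrow> k < size M \<Longrightarrow> y j < y k"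
    "\<And>k. k < size M \<Longrightarrow> phase M (y k) = real k * (pi / 2)"
proof -
  have "\<exists>y. phase M y = real k * (pi / 2)" if "k < size M" for k
  proof -
    have "real k * (pi / 2) < real (size M) * (pi / 2)" using that by simp
    from order_tendstoD(1)[OF phase_tendsto[OF M] this]
    obtain b where b: "b \<ge> 0" "real k * (pi / 2) < phase M b"
      unfolding eventually_at_top_linorder by (metis linorder_linear)
    have "continuous_on {0..b} (phase M)"
      using phase_continuous[OF M] continuous_on_subset by blast
    then obtain y where "0 \<le> y" "y \<le> b" "phase M y = real k * (pi / 2)"
      using IVT'[of "phase M" 0 "real k * (pi / 2)" b] b phase_0[OF cnj] by auto
    then show ?thesis by blast
  qed
  then obtain y0 where y0: "\<And>k. k < size M \<Longrightarrow> phase M (y0 k) = real k * (pi / 2)" by metis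
  \<comment> \<open>Level 0 is attained at 0 itself. Setting the value by hand yields
    \<open>y 0 = 0\<close> even for empty \<open>M\<close>, where \<open>y0\<close> is
    unconstrained.\<close>
  define y where "y k = (if k = 0 then 0 else y0 k)" for k :: nat
  have y: "phase M (y k) = real k * (pi / 2)" if "k < size M" for k
    using y0[OF that] phase_0[OF cnj] by (simp add: y_def)
  have "y j < y k" if "j < k" "k < size M" for j k
  proof (rule ccontr)
    assume "\<not> y j < y k"
    then have "phase M (y k) \<le> phase M (y j)"
      using phase_strict_mono[OF M, of "y k" "y j"] that by (cases "y k = y j") fastforce+
    then show False using y[of j] y[of k] that by simp
  qed
  then show ?thesis using that[of y] y by (simp add: y_def)
qed

text \<open>Real coefficients give C(z) = \<open>cnj\<close> (C(\<open>cnj z\<close>)), so the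
  factorizations over the roots and over their conjugates agree as polynomials. Comparing root
  multisets keeps the multiplicities.\<close>

lemma image_cnj_proots_of_real:
  "image_mset cnj (proots (map_poly complex_of_real p)) = proots (map_poly complex_of_real p)"
proof (cases "p = 0")
  case False
  let ?C = "map_poly complex_of_real p"
  let ?N = "image_mset cnj (proots ?C)"
  have C0: "lead_coeff ?C \<noteq> 0" using False by (simp add: map_poly_eq_0_iff)
  have C: "?C = smult (lead_coeff ?C) (\<Prod>r\<in>#proots ?C. [:-r, 1:])"
    by (rule complex_poly_decompose_multiset[symmetric])
  have prod_cnj: "cnj (\<Prod>r\<in>#K. cnj z - r) = (\<Prod>r\<in>#image_mset cnj K. z - r)" for K z
    by (induction K) simp_all
  have lc: "cnj (lead_coeff ?C) = lead_coeff ?C" by (simp add: coeff_map_poly)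
  have "poly ?C z = poly (smult (lead_coeff ?C) (\<Prod>r\<in>#?N. [:-r, 1:])) z" for z
  proof -
    have "poly ?C z = cnj (poly ?C (cnj z))"
      by (subst poly_cnj_real) (simp_all add: coeff_map_poly)
    also have "poly ?C (cnj z) = lead_coeff ?C * (\<Prod>r\<in>#proots ?C. cnj z - r)"
      by (subst C) (simp add: poly_prod_mset)
    finally show ?thesis
      by (simp add: poly_prod_mset prod_cnj lc del: image_mset.compositionality)
  qed
  then have "?C = smult (lead_coeff ?C) (\<Prod>r\<in>#?N. [:-r, 1:])" by (rule poly_ext)
  then have "proots ?C = proots (\<Prod>r\<in>#?N. [:-r, 1:])"
    using proots_smult[OF C0] by metis
  also have "\<dots> = ?N"
  proof -
    have "proots (\<Prod>r\<in>#K. [:-r, 1:]) = K" for K :: "complex multiset"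
    proof (induction K)
      case (add r K)
      have "(\<Prod>r\<in>#K. [:-r, 1:]) \<noteq> 0" by (auto simp: prod_mset_zero_iff)
      then have "proots ([:-r, 1:] * (\<Prod>r\<in>#K. [:-r, 1:])) = {#r#} + K"
        by (subst proots_mult) (use add in auto)
      then show ?case by simp
    qed simp
    then show ?thesis .
  qed
  finally show ?thesis by simp
qed simp

lemma T_zeros:
  assumes "n \<ge> 1"
  obtains y :: "nat \<Rightarrow> real" where "y 0 = 0" "\<And>j k. j < k \<Longrightarrow> k < n - 1 \<Longrightarrow> y j < y k"
    "\<And>k. k < n - 1 \<Longrightarrow> even k \<Longrightarrow> poly (T_E n) (- (y k)\<^sup>2) = 0"
    "\<And>k. k < n - 1 \<Longrightarrow> odd k \<Longrightarrow> poly (T_O n) (- (y k)\<^sup>2) = 0"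
proof -
  let ?C = "map_poly complex_of_real (run_poly n)"
  define M where "M = proots ?C - {#0#}"
  have n0: "run_poly n \<noteq> 0" using degree_run_poly[OF assms] assms by auto
  then have C0: "?C \<noteq> 0" by (simp add: map_poly_eq_0_iff)
  have C_at_0: "poly ?C 0 = 0" "poly (pderiv ?C) 0 = 1"
  proof -
    have "poly (run_poly n) 0 = 0" "poly (pderiv (run_poly n)) 0 = 1"
      using poly_T_0[OF assms]
      by (simp_all add: run_poly_def poly_pcompose pderiv_add pderiv_mult pderiv_pcompose pderiv_pCons)
    then show "poly ?C 0 = 0" "poly (pderiv ?C) 0 = 1"
      using poly_map_poly_of_real[of "run_poly n" 0] poly_map_poly_of_real[of "pderiv (run_poly n)" 0]
      by (simp_all add: map_poly_of_real_pderiv)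
  qed
  have order: "order 0 ?C = 1"
  proof -
    have "order 0 ?C = Suc (order 0 (pderiv ?C))" by (rule order_pderiv[OF C0 C_at_0(1)])
    also have "order 0 (pderiv ?C) = 0" using C_at_0(2) by (simp add: order_0I)
    finally show ?thesis by simp
  qed
  have roots: "proots ?C = add_mset 0 M"
    unfolding M_def using C_at_0(1) C0 by simp
  have Re_neg: "\<forall>r\<in>#M. Re r < 0"
  proof
    fix r assume r: "r \<in># M"
    \<comment> \<open>The zero 0 is simple, so removing it once removes it entirely and the
      remaining real parts are strictly negative.\<close>
    have "count M 0 = 0" using order C0 by (simp add: M_def)
    then have "r \<noteq> 0" using r by (metis not_in_iff)
    moreover have "r \<in># proots ?C" using r roots by simp
    ultimately show "Re r < 0" using zeros_run_poly[OF assms, of r] C0 by simp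
  qed
  have cnj: "image_mset cnj M = M"
    using image_cnj_proots_of_real[of "run_poly n"] unfolding roots by simp
  have size: "size M = n - 1"
  proof -
    have "size (proots ?C) = n"
      using degree_run_poly[OF assms] by (simp add: size_proots_complex degree_map_poly)
    then show ?thesis unfolding roots by simp
  qed
  obtain y where y: "y 0 = 0" "\<And>j k. j < k \<Longrightarrow> k < n - 1 \<Longrightarrow> y j < y k"
    "\<And>k. k < n - 1 \<Longrightarrow> phase M (y k) = real k * (pi / 2)"
    using phase_levels[OF Re_neg cnj] unfolding size by blast
  \<comment> \<open>Both sides are \<open>run_poly n\<close> at ix: split into even and odd part on
    the left, factored over its roots on the right. Hence \<open>T_E n\<close> carries the sine of
    the phase and \<open>T_O n\<close> the cosine.\<close>
  have key: "\<exists>c. of_real (poly (T_E n) (- x\<^sup>2)) + \<i> * of_real (x * poly (T_O n) (- x\<^sup>2)) =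
      \<i> * of_real (x * c) * cis (phase M x)" for x
  proof -
    obtain \<rho> where \<rho>: "(\<Prod>r\<in>#M. \<i> * of_real x - r) = of_real \<rho> * cis (phase M x)"
      using prod_eq_cis_phase[OF Re_neg] by blast
    have sq: "(\<i> * of_real x) * (\<i> * of_real x) = complex_of_real (- x\<^sup>2)"
      by (simp add: complex_eq_iff power2_eq_square)
    have "poly ?C (\<i> * of_real x) = of_real (poly (T_E n) (- x\<^sup>2)) + \<i> * of_real (x * poly (T_O n) (- x\<^sup>2))"
      unfolding run_poly_def
      by (simp add: map_poly_of_real_add map_poly_of_real_mult map_poly_of_real_pcompose map_poly_pCons
          poly_pcompose sq poly_map_poly_of_real del: mult_pCons_left of_real_minus of_real_power)
    moreover have "poly ?C (\<i> * of_real x) =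
        of_real (lead_coeff (run_poly n)) * (\<i> * of_real x * (of_real \<rho> * cis (phase M x)))"
      by (subst complex_poly_decompose_multiset[of ?C, symmetric])
         (simp add: poly_prod_mset roots \<rho> degree_map_poly coeff_map_poly)
    ultimately have "of_real (poly (T_E n) (- x\<^sup>2)) + \<i> * of_real (x * poly (T_O n) (- x\<^sup>2)) =
      \<i> * of_real (x * (lead_coeff (run_poly n) * \<rho>)) * cis (phase M x)"
      by (simp add: mult_ac)
    then show ?thesis by blast
  qed
  show ?thesis
  proof (rule that[of y])
    fix k assume k: "k < n - 1" "even k"
    then obtain j where j: "k = 2 * j" by (elim evenE)
    have "phase M (y k) = real j * pi" using y(3)[OF k(1)] by (simp add: j)
    then have "sin (phase M (y k)) = 0" by simp
    then show "poly (T_E n) (- (y k)\<^sup>2) = 0"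
      using key[of "y k"] by (auto simp: complex_eq_iff)
  next
    fix k assume k: "k < n - 1" "odd k"
    then obtain j where j: "k = 2 * j + 1" by (elim oddE)
    have "phase M (y k) = real j * pi + pi / 2"
      using y(3)[OF k(1)] by (simp add: j algebra_simps add_divide_distrib)
    then have "cos (phase M (y k)) = 0" by (simp add: cos_add)
    \<comment> \<open>The imaginary part is \<open>y k\<close> times the value of
      \<open>T_O n\<close>, so this factor must be nonzero.\<close>
    moreover have "y k > 0" using y(2)[of 0 k] y(1) k by (cases k) auto
    ultimately show "poly (T_O n) (- (y k)\<^sup>2) = 0"
      using key[of "y k"] by (auto simp: complex_eq_iff)
  qed (use y in auto)
qed

section \<open>Interlacing\<close>

text \<open>As many distinct zeros as the degree allows leave no room for multiplicities or further
  zeros.\<close>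

lemma proots_eq_mset_set:
  fixes p :: "'a :: idom poly"
  assumes "p \<noteq> 0" "finite Z" "\<And>z. z \<in> Z \<Longrightarrow> poly p z = 0" "degree p \<le> card Z"
  shows "proots p = mset_set Z" "degree p = card Z"
proof -
  have "mset_set Z \<subseteq># proots p"
  proof (rule mset_subset_eqI)
    fix z
    show "count (mset_set Z) z \<le> count (proots p) z"
    proof (cases "z \<in> Z")
      case True
      then have "order z p \<noteq> 0" using assms(1,3) order_root by blast
      then show ?thesis using assms(1,2) True by simp
    qed simp
  qed
  moreover from size_mset_mono[OF this] size_proots_le[of p] assms(4)
  have "degree p = card Z" "size (proots p) = size (mset_set Z)" by simp_all
  ultimately show "proots p = mset_set Z" "degree p = card Z"
    using mset_subset_size subset_mset.le_imp_less_or_eq by fastforce+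
qed

lemma sorted_list_of_set_decreasing:
  fixes f :: "nat \<Rightarrow> 'a :: linorder"
  assumes "\<And>i j. i < j \<Longrightarrow> j < d \<Longrightarrow> f j < f i"
  shows "sorted_list_of_set (f ` {..<d}) = rev (map f [0..<d])" "card (f ` {..<d}) = d"
proof -
  have inj: "inj_on f {..<d}"
    by (rule inj_onI) (metis assms lessThan_iff less_irrefl linorder_neqE_nat)
  have "sorted (rev (map f [0..<d]))"
    unfolding sorted_rev_iff_nth_mono using assms by (auto simp: le_less)
  moreover have "distinct (rev (map f [0..<d]))"
    using inj by (simp add: distinct_map lessThan_atLeast0)
  moreover have "set (rev (map f [0..<d])) = f ` {..<d}" by (auto simp: lessThan_atLeast0)
  ultimately show "sorted_list_of_set (f ` {..<d}) = rev (map f [0..<d])"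
    by (metis sorted_list_of_set.idem_if_sorted_distinct)
  show "card (f ` {..<d}) = d" using card_image[OF inj] by simp
qed

text \<open>The zeros arrive in decreasing order, since -y^2 falls as y grows from 0, whereas
  \<open>sorted_zeros\<close> is increasing; hence the reversal.\<close>

lemma zeros_of_decreasing:
  fixes p :: "real poly"
  assumes "p \<noteq> 0" "degree p \<le> d" "\<And>i j. i < j \<Longrightarrow> j < d \<Longrightarrow> f j < f i"
    "\<And>i. i < d \<Longrightarrow> poly p (f i) = 0"
  shows "degree p = d" "sorted_zeros p = rev (map f [0..<d])"
    "complex_zeros p = mset_set (complex_of_real ` f ` {..<d})"
proof -
  note s = sorted_list_of_set_decreasing[of d f, OF assms(3)]
  have "proots p = mset_set (f ` {..<d})" and deg: "degree p = card (f ` {..<d})"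
    by (rule proots_eq_mset_set; use assms s(2) in auto)+
  then show "degree p = d" "sorted_zeros p = rev (map f [0..<d])"
    by (simp_all add: sorted_zeros_def s)
  show "complex_zeros p = mset_set (complex_of_real ` f ` {..<d})"
    unfolding complex_zeros_def
  proof (rule proots_eq_mset_set(1))
    show "map_poly complex_of_real p \<noteq> 0" using assms(1) by (simp add: map_poly_eq_0_iff)
    show "degree (map_poly complex_of_real p) \<le> card (complex_of_real ` f ` {..<d})"
      using deg by (simp add: degree_map_poly card_image inj_on_def)
  qed (use assms(4) poly_map_poly_of_real in auto)
qed

theorem theorem2p10:
  fixes n :: nat
  assumes "n \<ge> 1"
  shows "T_E (n + 1) = of_nat n * [:0, 1:] * T_E n
             + 2 * [:0, 1:] * (1 - [:0, 1:]) * pderiv (T_E n) + [:0, 1:] * T_O n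
       \<and> T_O (n + 1) = ((of_nat n - 1) * [:0, 1:] + 1) * T_O n
             + 2 * [:0, 1:] * (1 - [:0, 1:]) * pderiv (T_O n) + T_E n
       \<and> T_E 1 = 0 \<and> T_O 1 = 1
       \<and> (\<forall>z \<in># complex_zeros (T_E n) - {#0#}. z \<in> \<real> \<and> Re z < 0)
       \<and> (\<forall>z \<in># complex_zeros (T_O n). z \<in> \<real> \<and> Re z < 0)
       \<and> T_O n \<prec> T_E n"
proof (cases "n = 1")
  \<comment> \<open>Here \<open>T_E 1 = 0\<close> and \<open>T_O 1 = 1\<close> both have degree 0
    and no listed zeros, so the equal-degree alternative of \<open>interlaces\<close> holds
    vacuously.\<close>
  case True
  then show ?thesis
    using T_E_Suc[OF assms] T_O_Suc[OF assms] T_1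
    by (simp add: complex_zeros_def real_rooted_def interlaces_def)
next
  case False
  with assms have n: "n \<ge> 2" by simp
  \<comment> \<open>These are the degree bounds of \<open>T_E n\<close> and \<open>T_O n\<close>,
    and also the numbers of even and odd indices below \<open>n - 1\<close>.\<close>
  define e o' where "e = n div 2" and "o' = (n - 1) div 2"
  obtain y where y: "y 0 = 0" "\<And>j k. j < k \<Longrightarrow> k < n - 1 \<Longrightarrow> y j < y k"
    "\<And>k. k < n - 1 \<Longrightarrow> even k \<Longrightarrow> poly (T_E n) (- (y k)\<^sup>2) = 0"
    "\<And>k. k < n - 1 \<Longrightarrow> odd k \<Longrightarrow> poly (T_O n) (- (y k)\<^sup>2) = 0"
    using T_zeros[OF assms] by metis
  define z where "z k = - (y k)\<^sup>2" for k
  have y_nonneg: "y k \<ge> 0" if "k < n - 1" for k using y(1) y(2)[of 0 k] that by (cases "k = 0") auto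
  have dec: "z k < z j" if "j < k" "k < n - 1" for j k
    unfolding z_def using y(2)[OF that] y_nonneg[of j] that by (simp add: power_strict_mono)
  have dec': "z k \<le> z j" if "j \<le> k" "k < n - 1" for j k
    using dec[of j k] that by (cases "j = k") auto
  have z0: "z 0 = 0" by (simp add: z_def y)
  have bound_e: "2 * j < n - 1" if "j < e" for j using that by (auto simp: e_def)
  have bound_o: "2 * j + 1 < n - 1" if "j < o'" for j using that by (auto simp: o'_def)
  have "T_O n \<noteq> 0" using poly_T_0(2)[OF assms] by auto
  have "e \<ge> 1" using n by (auto simp: e_def)
  have E: "degree (T_E n) = e" "sorted_zeros (T_E n) = rev (map (\<lambda>j. z (2 * j)) [0..<e])"
      "complex_zeros (T_E n) = mset_set (complex_of_real ` (\<lambda>j. z (2 * j)) ` {..<e})"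
  proof -
    have 1: "degree (T_E n) \<le> e" using degree_T_le(1) by (simp add: e_def)
    have 2: "z (2 * j) < z (2 * i)" if "i < j" "j < e" for i j
      using that dec bound_e by simp
    have 3: "poly (T_E n) (z (2 * i)) = 0" if "i < e" for i
      using that y(3) bound_e by (simp add: z_def)
    show "degree (T_E n) = e" "sorted_zeros (T_E n) = rev (map (\<lambda>j. z (2 * j)) [0..<e])"
      "complex_zeros (T_E n) = mset_set (complex_of_real ` (\<lambda>j. z (2 * j)) ` {..<e})"
      using zeros_of_decreasing[where f = "\<lambda>j. z (2 * j)", OF T_E_nonzero[OF n] 1 2 3] by simp_all
  qed
  have O: "degree (T_O n) = o'" "sorted_zeros (T_O n) = rev (map (\<lambda>j. z (2 * j + 1)) [0..<o'])"
      "complex_zeros (T_O n) = mset_set (complex_of_real ` (\<lambda>j. z (2 * j + 1)) ` {..<o'})"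
  proof -
    have 1: "degree (T_O n) \<le> o'" using degree_T_le(2) by (simp add: o'_def)
    have 2: "z (2 * j + 1) < z (2 * i + 1)" if "i < j" "j < o'" for i j
      using that dec bound_o[of j] by simp
    have 3: "poly (T_O n) (z (2 * i + 1)) = 0" if "i < o'" for i
      using that y(4)[of "2 * i + 1"] bound_o[of i] by (simp add: z_def)
    show "degree (T_O n) = o'" "sorted_zeros (T_O n) = rev (map (\<lambda>j. z (2 * j + 1)) [0..<o'])"
      "complex_zeros (T_O n) = mset_set (complex_of_real ` (\<lambda>j. z (2 * j + 1)) ` {..<o'})"
      using zeros_of_decreasing[where f = "\<lambda>j. z (2 * j + 1)", OF \<open>T_O n \<noteq> 0\<close> 1 2 3] by simp_all
  qed
  have negE: "\<forall>w \<in># complex_zeros (T_E n) - {#0#}. w \<in> \<real> \<and> Re w < 0"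
  proof
    fix w assume w: "w \<in># complex_zeros (T_E n) - {#0#}"
    \<comment> \<open>The discarded trivial zero is \<open>z 0\<close>; every later \<open>z\<close>
      is strictly negative.\<close>
    have "0 \<in> complex_of_real ` (\<lambda>j. z (2 * j)) ` {..<e}"
      using \<open>e \<ge> 1\<close> z0 by (auto simp: image_iff intro!: bexI[of _ 0])
    then have "complex_zeros (T_E n) - {#0#} = mset_set (complex_of_real ` (\<lambda>j. z (2 * j)) ` {..<e} - {0})"
      unfolding E(3) by (subst mset_set_Diff) auto
    with w have "w \<in> complex_of_real ` (\<lambda>j. z (2 * j)) ` {..<e} - {0}" by simp
    then obtain j where j: "j < e" "w = of_real (z (2 * j))" "w \<noteq> 0" by auto
    then have "j \<noteq> 0" using z0 by (cases j) auto
    then show "w \<in> \<real> \<and> Re w < 0" using j dec[of 0 "2 * j"] bound_e[of j] z0 by auto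
  qed
  have negO: "\<forall>w \<in># complex_zeros (T_O n). w \<in> \<real> \<and> Re w < 0"
  proof
    fix w assume "w \<in># complex_zeros (T_O n)"
    then obtain j where j: "j < o'" "w = of_real (z (2 * j + 1))" unfolding O(3) by auto
    then show "w \<in> \<real> \<and> Re w < 0" using dec[of 0 "2 * j + 1"] bound_o[of j] z0 by simp
  qed
  have nthE: "sorted_zeros (T_E n) ! i = z (2 * (e - Suc i))" if "i < e" for i
    using that by (simp add: E(2) rev_nth)
  have nthO: "sorted_zeros (T_O n) ! i = z (2 * (o' - Suc i) + 1)" if "i < o'" for i
    using that by (simp add: O(2) rev_nth)
  have real: "real_rooted (T_E n)" "real_rooted (T_O n)"
    unfolding real_rooted_def E(3) O(3) by auto
  have "T_O n \<prec> T_E n"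
  proof (cases "even n")
    case True
    then have eo: "e = Suc o'" using n by (auto simp: e_def o'_def elim!: evenE)
    \<comment> \<open>With s = 2(o' - i) the indices are s, s - 1, s - 2, and \<open>z\<close>
      decreases.\<close>
    have "z (2 * (e - Suc i)) \<le> z (2 * (o' - Suc i) + 1) \<and> z (2 * (o' - Suc i) + 1) \<le> z (2 * (e - Suc (i + 1)))"
      if "i < o'" for i
      using that eo by (intro conjI dec' bound_o bound_e) auto
    then show ?thesis unfolding interlaces_def Let_def E(1) O(1)
      using real eo nthE nthO by simp
  next
    case False
    then have eo: "e = o'" using n by (auto simp: e_def o'_def elim!: oddE)
    \<comment> \<open>With s = 2(e - i) the indices in this and the next inequality are s - 1, s -
      2, s - 3.\<close>
    have "z (2 * (o' - Suc i) + 1) \<le> z (2 * (e - Suc i))" if "i < o'" for i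
      using that eo by (intro dec' bound_o) auto
    moreover have "z (2 * (e - Suc i)) \<le> z (2 * (o' - Suc (i + 1)) + 1)" if "i + 1 < o'" for i
      using that eo by (intro dec' bound_e) auto
    ultimately show ?thesis unfolding interlaces_def Let_def E(1) O(1)
      using real eo nthE nthO by simp
  qed
  then show ?thesis using T_E_Suc[OF assms] T_O_Suc[OF assms] T_1 negE negO by blast
qed

end
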